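(* Let $0<q\le 2$, let $k,n$ be integers with $1\le k<n$, and let $X=(X_1,\dots,X_n)$ be a symmetric $q$-stable random vector in $\mathbb{R}^n$. Let $\mathcal{A}(X,k)$ be the set of all $n$-dimensional symmetric $q$-stable random vectors whose first $k$ coordinates have the same joint distribution as $X_1,\dots,X_k$ and whose last $n-k$ coordinates have the same joint distribution as $X_{k+1},\dots,X_n$. Let $Y=(Y_1,\dots,Y_n)$ be the vector from $\mathcal{A}(X,k)$ for which $Y_i$ and $Y_j$ are independent for every $1\le i\le k$, $k+1\le j\le n$. Let $p>0$ and let $B=(\mathbb{R}^n,\|\cdot\|)$ be a subspace of $L_p$ satisfying $$\|(u,v)\|=\|(u,-v)\|\qquad\text{for all }u\in\mathbb{R}^k,\ v\in\mathbb{R}^{n-k}.$$ If $0<p\le q$, then $$\mathbb{E}\big(\|Y\|^p\big)=\max\{\mathbb{E}\big(\|Z\|^p\big):\ Z\in\mathcal{A}(X,k)\}.$$ Also, if $q=2$ and $p>2$, then $$\mathbb{E}\big(\|Y\|^p\big)=\min\{\mathbb{E}\big(\|Z\|^p\big):\ Z\in\mathcal{A}(X,k)\}.$$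
   Context: Symmetric $q$-stable vector: $X$ is a symmetric $q$-stable random vector in $\mathbb{R}^n$ ($0<q\le 2$) if its characteristic functional has the form $\phi(\xi)=\exp\big(-\|\sum_{i=1}^n\xi_is_i\|_q^q\big)$, $\xi\in\mathbb{R}^n$, for some real-valued $s_1,\dots,s_n\in L_q([0,1])$, where $\|s\|_q^q=\int_0^1|s|^q$. With this notation the vector $Y$ has characteristic functional $\phi_0(\xi)=\exp\big(-\|\sum_{i=1}^k\xi_is_i\|_q^q-\|\sum_{i=k+1}^n\xi_is_i\|_q^q\big)$. Expectations of non-negative quantities are understood in $[0,+\infty]$ (for $q<2$ and $p=q$ they may be infinite). "$B=(\mathbb{R}^n,\|\cdot\|)$ is a subspace of $L_p$" means that $B$ is $n$-dimensional and there is a linear map $T$ from $\mathbb{R}^n$ into the real space $L_p([0,1])$ with $\|x\|=\|Tx\|_{L_p}$ for all $x\in\mathbb{R}^n$, where $\|f\|_{L_p}=(\int|f|^p)^{1/p}$ (a quasi-norm if $p<1$), and $\|x\|>0$ for $x\ne0$. *)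

theory Defs
  imports "HOL-Probability.Probability"
begin

abbreviation unit_interval :: "real measure" where
  "unit_interval \<equiv> lebesgue_on {0..1}"

text \<open>Elements of \<open>L_p([0,1])\<close> are represented by functions; identification up to null sets
  is expressed with \<open>AE\<close> where it matters. No assumption \<open>p \<ge> 1\<close> is made.\<close>

definition Lp_space :: "real \<Rightarrow> (real \<Rightarrow> real) set" where
  "Lp_space p = {f. f \<in> borel_measurable unit_interval \<and>
                    integrable unit_interval (\<lambda>t. \<bar>f t\<bar> powr p)}"

definition Lp_norm :: "real \<Rightarrow> (real \<Rightarrow> real) \<Rightarrow> real" where
  "Lp_norm p f = (LINT t|unit_interval. \<bar>f t\<bar> powr p) powr (1 / p)"

definition char_functional ::
  "'a measure \<Rightarrow> ('a \<Rightarrow> 'v::euclidean_space) \<Rightarrow> 'v \<Rightarrow> complex" where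
  "char_functional M X \<xi> = (CLINT \<omega>|M. iexp (\<xi> \<bullet> X \<omega>))"

text \<open>The coordinates of \<open>\<xi>\<close> are \<open>\<xi> \<bullet> b\<close> for \<open>b \<in> Basis\<close>, so \<open>s b\<close> is the function attached
  to the coordinate \<open>b\<close>. The exponent is \<open>\<parallel>\<Sum> \<xi>_i s_i\<parallel>_q^q\<close>, that is, the integral itself.\<close>

definition symmetric_stable ::
  "real \<Rightarrow> 'a measure \<Rightarrow> ('a \<Rightarrow> 'v::euclidean_space) \<Rightarrow> bool" where
  "symmetric_stable q M X \<longleftrightarrow>
     prob_space M \<and> X \<in> borel_measurable M \<and>
     (\<exists>s. (\<forall>b\<in>Basis. s b \<in> Lp_space q) \<and>
          (\<forall>\<xi>. char_functional M X \<xi> =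
             complex_of_real (exp (- (LINT t|unit_interval.
               \<bar>\<Sum>b\<in>Basis. (\<xi> \<bullet> b) * s b t\<bar> powr q)))))"

text \<open>\<open>\<real>^n\<close> is written as \<open>\<real>^k \<times> \<real>^(n-k)\<close>: with \<open>k = CARD('k)\<close> and \<open>n = CARD('k) + CARD('m)\<close>,
  both blocks are nonempty because types are, so these are exactly the pairs \<open>1 \<le> k < n\<close>.
  A random vector is a pair of a probability space and a measurable map on it. The class
  consists of all such pairs whose sample space lives in the type \<open>'b\<close>, which need not be the
  sample type of \<open>X\<close>. Taking \<open>'b\<close> to be \<open>\<real>^k \<times> \<real>^(n-k)\<close> covers every law.\<close>

definition stable_class ::
  "real \<Rightarrow> 'a measure \<Rightarrow> ('a \<Rightarrow> (real ^ 'k) \<times> (real ^ 'm)) \<Rightarrow>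
   ('b measure \<times> ('b \<Rightarrow> (real ^ 'k) \<times> (real ^ 'm))) set" where
  "stable_class q M X = {(P, Z). symmetric_stable q P Z \<and>
     distr P borel (\<lambda>\<omega>. fst (Z \<omega>)) = distr M borel (\<lambda>\<omega>. fst (X \<omega>)) \<and>
     distr P borel (\<lambda>\<omega>. snd (Z \<omega>)) = distr M borel (\<lambda>\<omega>. snd (X \<omega>))}"

text \<open>The map \<open>T\<close> is linear as a map into \<open>L_p([0,1])\<close>, i.e. modulo null sets.\<close>

definition subspace_of_Lp :: "real \<Rightarrow> ('v::euclidean_space \<Rightarrow> real) \<Rightarrow> bool" where
  "subspace_of_Lp p nrm \<longleftrightarrow>
     (\<exists>T :: 'v \<Rightarrow> real \<Rightarrow> real.
        (\<forall>x. T x \<in> Lp_space p) \<and>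
        (\<forall>x y. AE t in unit_interval. T (x + y) t = T x t + T y t) \<and>
        (\<forall>c x. AE t in unit_interval. T (c *\<^sub>R x) t = c * T x t) \<and>
        (\<forall>x. nrm x = Lp_norm p (T x))) \<and>
     (\<forall>x. x \<noteq> 0 \<longrightarrow> nrm x > 0)"

definition expected_power ::
  "real \<Rightarrow> ('v \<Rightarrow> real) \<Rightarrow> 'a measure \<Rightarrow> ('a \<Rightarrow> 'v) \<Rightarrow> ennreal" where
  "expected_power p nrm M X = (\<integral>\<^sup>+ \<omega>. ennreal (nrm (X \<omega>) powr p) \<partial>M)"

text \<open>Maxima and minima of possibly infinite sets, including that they are attained;
  \<^const>\<open>Max\<close> and \<^const>\<open>Min\<close> are only meaningful for finite sets.\<close>

definition is_maximum :: "'a::linorder \<Rightarrow> 'a set \<Rightarrow> bool" where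
  "is_maximum m S \<longleftrightarrow> m \<in> S \<and> (\<forall>x\<in>S. x \<le> m)"

definition is_minimum :: "'a::linorder \<Rightarrow> 'a set \<Rightarrow> bool" where
  "is_minimum m S \<longleftrightarrow> m \<in> S \<and> (\<forall>x\<in>S. m \<le> x)"

end

theory Submission
  imports Defs
begin

text \<open>Write \<open>\<sigma>\<^sub>Z(\<xi>) = \<parallel>\<Sum> \<xi>_i s_i\<parallel>_q^q\<close>. By Tonelli, \<open>E(\<parallel>Z\<parallel>^p)\<close> is an integral of moments of the scalar
  variables \<open>\<langle>G t, Z\<rangle>\<close>, and by scaling each of these is \<open>c \<sigma>\<^sub>Z(G t)^(p/q)\<close> with the same \<open>c \<in> [0, \<infinity>]\<close>.
  Since the marginals are prescribed and \<open>q \<le> 2\<close>, the parallelogram inequality gives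
  \<open>\<sigma>\<^sub>Z(u, v) + \<sigma>\<^sub>Z(u, -v) \<le> 2 (\<sigma>\<^sub>Z(u, 0) + \<sigma>\<^sub>Z(0, v)) = 2 \<sigma>\<^sub>Y(u, v)\<close>, with equality for \<open>q = 2\<close>.
  The symmetry of the norm allows averaging over \<open>(u, v)\<close> and \<open>(u, -v)\<close>, and concavity (for
  \<open>p \<le> q\<close>) or convexity (for \<open>q = 2 < p\<close>) of \<open>x^(p/q)\<close> concludes.\<close>

section \<open>Scalar power inequalities\<close>

text \<open>Midpoint concavity of \<open>z powr r\<close>: both values lie below the tangent line at
  \<open>m = (x + y) / 2\<close>, whose heights at \<open>x\<close> and \<open>y\<close> average to
  \<open>m powr r\<close>.\<close>

lemma powr_mean_le:
  fixes x y r :: real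
  assumes "0 \<le> x" "0 \<le> y" "0 < r" "r \<le> 1"
  shows "x powr r + y powr r \<le> 2 * ((x + y) / 2) powr r"
proof -
  \<comment> \<open>The right-hand side is the tangent line at \<open>m\<close>, written as a
    weighted arithmetic mean times \<open>m powr (r - 1)\<close> so that Young's inequality
    applies.\<close>
  have tangent: "z powr r \<le> (r * z + (1 - r) * m) * m powr (r - 1)" if "0 \<le> z" "0 < m" for z m :: real
  proof (cases "z = 0")
    case True
    with that assms show ?thesis by simp
  next
    case False
    have "z powr r * m powr (1 - r) \<le> r * z + (1 - r) * m"
      using Youngs_inequality_0[of r "1 - r" z m] that False assms by simp
    then have "z powr r * m powr (1 - r) * m powr (r - 1) \<le> (r * z + (1 - r) * m) * m powr (r - 1)"
      by (intro mult_right_mono) auto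
    moreover have "m powr (1 - r) * m powr (r - 1) = 1"
      using that by (simp flip: powr_add)
    ultimately show ?thesis by (simp add: mult.assoc)
  qed
  show ?thesis
  proof (cases "x + y = 0")
    case True
    then have "x = 0" "y = 0" using assms by auto
    then show ?thesis by simp
  next
    case False
    define m where "m = (x + y) / 2"
    have m: "0 < m" using False assms by (simp add: m_def)
    have "x powr r + y powr r \<le> (r * (x + y) + (1 - r) * (2 * m)) * m powr (r - 1)"
      using tangent[OF assms(1) m] tangent[OF assms(2) m] by (simp add: algebra_simps)
    also have "\<dots> = 2 * (m * m powr (r - 1))"
      by (simp add: m_def field_simps)
    also have "m * m powr (r - 1) = m powr r"
      using m by (simp add: powr_diff)
    finally show ?thesis by (simp add: m_def)
  qed
qed

text \<open>Concavity of the power \<open>1 / r\<close>, applied to \<open>x powr r\<close> and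
  \<open>y powr r\<close> and then raised back to the power \<open>r\<close>.\<close>

lemma powr_mean_ge:
  fixes x y r :: real
  assumes "0 \<le> x" "0 \<le> y" "1 \<le> r"
  shows "2 * ((x + y) / 2) powr r \<le> x powr r + y powr r"
proof -
  have "(x powr r) powr (1 / r) + (y powr r) powr (1 / r) \<le> 2 * ((x powr r + y powr r) / 2) powr (1 / r)"
    using assms by (intro powr_mean_le) auto
  then have "(x + y) / 2 \<le> ((x powr r + y powr r) / 2) powr (1 / r)"
    using assms by (simp add: powr_powr)
  then have "((x + y) / 2) powr r \<le> (((x powr r + y powr r) / 2) powr (1 / r)) powr r"
    using assms by (intro powr_mono2) auto
  then show ?thesis using assms by (simp add: powr_powr)
qed

text \<open>After one factor \<open>x + y\<close> is split off, the remaining power has the negative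
  exponent \<open>r - 1\<close> and grows strictly when \<open>x + y\<close> shrinks to either
  summand.\<close>

lemma powr_add_less:
  fixes x y r :: real
  assumes "0 < x" "0 < y" "r < 1"
  shows "(x + y) powr r < x powr r + y powr r"
proof -
  have "(x + y) powr r = (x + y) * (x + y) powr (r - 1)"
    using assms by (simp add: powr_diff)
  also have "\<dots> = x * (x + y) powr (r - 1) + y * (x + y) powr (r - 1)"
    by (rule distrib_right)
  also have "\<dots> < x * x powr (r - 1) + y * y powr (r - 1)"
    using assms by (intro add_strict_mono mult_strict_left_mono powr_less_mono2_neg) auto
  also have "\<dots> = x powr r + y powr r"
    using assms by (simp add: powr_diff)
  finally show ?thesis .
qed

lemma powr_add_le:
  fixes x y r :: real
  assumes "0 \<le> x" "0 \<le> y" "r \<le> 1"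
  shows "(x + y) powr r \<le> x powr r + y powr r"
proof (cases "0 < x \<and> 0 < y \<and> r < 1")
  case True
  then show ?thesis using powr_add_less[of x y r] by auto
next
  case False
  then show ?thesis using assms by (cases "r = 1") (auto simp: order.order_iff_strict)
qed

text \<open>Since \<open>q / 2 \<le> 1\<close>, concavity applied to the squares of
  \<open>a + b\<close> and \<open>a - b\<close> bounds the left side by
  \<open>2 * (a^2 + b^2) powr (q / 2)\<close>. Subadditivity finishes, and it is strict in the
  second case.\<close>

lemma abs_powr_parallelogram:
  fixes a b q :: real
  assumes "0 < q" "q \<le> 2"
  shows abs_powr_parallelogram_le:
      "\<bar>a + b\<bar> powr q + \<bar>a - b\<bar> powr q \<le> 2 * (\<bar>a\<bar> powr q + \<bar>b\<bar> powr q)" (is ?le)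
    and abs_powr_parallelogram_less:
      "q < 2 \<Longrightarrow> a \<noteq> 0 \<Longrightarrow> b \<noteq> 0 \<Longrightarrow>
        \<bar>a + b\<bar> powr q + \<bar>a - b\<bar> powr q < 2 * (\<bar>a\<bar> powr q + \<bar>b\<bar> powr q)"
proof -
  have sq: "\<bar>z\<bar> powr q = (z\<^sup>2) powr (q / 2)" for z :: real
  proof (cases "z = 0")
    case False
    then have "z\<^sup>2 = \<bar>z\<bar> powr 2" by simp
    then show ?thesis by (simp only: powr_powr) simp
  qed (use assms in simp)
  have "((a + b)\<^sup>2 + (a - b)\<^sup>2) / 2 = a\<^sup>2 + b\<^sup>2"
    by (simp add: power2_eq_square field_simps)
  with powr_mean_le[of "(a + b)\<^sup>2" "(a - b)\<^sup>2" "q / 2"] assms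
  have *: "\<bar>a + b\<bar> powr q + \<bar>a - b\<bar> powr q \<le> 2 * (a\<^sup>2 + b\<^sup>2) powr (q / 2)"
    unfolding sq by simp
  show ?le
    using * powr_add_le[of "a\<^sup>2" "b\<^sup>2" "q / 2"] assms by (simp add: sq)
  show "\<bar>a + b\<bar> powr q + \<bar>a - b\<bar> powr q < 2 * (\<bar>a\<bar> powr q + \<bar>b\<bar> powr q)"
    if "q < 2" "a \<noteq> 0" "b \<noteq> 0"
    using * powr_add_less[of "a\<^sup>2" "b\<^sup>2" "q / 2"] assms that by (simp add: sq)
qed

section \<open>Powers of \<open>L_p\<close> quasi-norms and linear combinations\<close>

text \<open>Without the root \<open>1 / p\<close> this is the form of a stable exponent, and it is
  homogeneous of degree \<open>p\<close>.\<close>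

definition Lp_power :: "real \<Rightarrow> (real \<Rightarrow> real) \<Rightarrow> real" where
  "Lp_power p f = (LINT t|unit_interval. \<bar>f t\<bar> powr p)"

text \<open>\<open>Lp_power q (lincomb s x)\<close> is the exponent of a stable vector at
  \<open>x\<close>. Linearity in \<open>x\<close> holds at every \<open>t\<close>, not merely almost
  everywhere.\<close>

definition lincomb :: "('v::euclidean_space \<Rightarrow> real \<Rightarrow> real) \<Rightarrow> 'v \<Rightarrow> real \<Rightarrow> real" where
  "lincomb s x t = (\<Sum>b\<in>Basis. (x \<bullet> b) * s b t)"

lemma linear_lincomb: "linear (\<lambda>x. lincomb s x t)"
  by (rule linearI) (simp_all add: lincomb_def inner_add_left distrib_right sum.distrib
      sum_distrib_left mult.assoc)

lemma Lp_power_nonneg [simp]: "0 \<le> Lp_power p f"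
  by (simp add: Lp_power_def)

lemma Lp_power_scale: "Lp_power p (\<lambda>t. c * f t) = \<bar>c\<bar> powr p * Lp_power p f"
  by (simp add: Lp_power_def abs_mult powr_mult)

lemma Lp_spaceD:
  assumes "f \<in> Lp_space p"
  shows "f \<in> borel_measurable unit_interval" "integrable unit_interval (\<lambda>t. \<bar>f t\<bar> powr p)"
  using assms by (auto simp: Lp_space_def)

lemma Lp_space_scale:
  assumes "f \<in> Lp_space p"
  shows "(\<lambda>t. c * f t) \<in> Lp_space p"
  using assms by (auto simp: Lp_space_def abs_mult powr_mult)

lemma Lp_space_add:
  assumes "0 < p" "f \<in> Lp_space p" "g \<in> Lp_space p"
  shows "(\<lambda>t. f t + g t) \<in> Lp_space p"
proof -
  note [measurable] = Lp_spaceD(1)[OF assms(2)] Lp_spaceD(1)[OF assms(3)]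
  \<comment> \<open>Bounding the sum by twice the maximum works for every \<open>p > 0\<close>,
    whereas the triangle inequality covers only \<open>p \<ge> 1\<close>.\<close>
  have "\<bar>a + b\<bar> powr p \<le> 2 powr p * (\<bar>a\<bar> powr p + \<bar>b\<bar> powr p)" for a b :: real
  proof -
    have "\<bar>a + b\<bar> powr p \<le> (2 * max \<bar>a\<bar> \<bar>b\<bar>) powr p"
      using assms by (intro powr_mono2) auto
    also have "\<dots> = 2 powr p * (max \<bar>a\<bar> \<bar>b\<bar>) powr p"
      by (simp add: powr_mult)
    also have "\<dots> \<le> 2 powr p * (\<bar>a\<bar> powr p + \<bar>b\<bar> powr p)"
      by (intro mult_left_mono) (auto simp: max_def)
    finally show ?thesis .
  qed
  then have bound: "AE t in unit_interval. norm (\<bar>f t + g t\<bar> powr p)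
      \<le> norm (2 powr p * (\<bar>f t\<bar> powr p + \<bar>g t\<bar> powr p))"
    by (intro AE_I2) simp
  have "integrable unit_interval (\<lambda>t. 2 powr p * (\<bar>f t\<bar> powr p + \<bar>g t\<bar> powr p))"
    by (intro integrable_mult_right Bochner_Integration.integrable_add Lp_spaceD(2) assms)
  then have "integrable unit_interval (\<lambda>t. \<bar>f t + g t\<bar> powr p)"
    by (rule Bochner_Integration.integrable_bound[OF _ _ bound]) measurable
  then show ?thesis by (simp add: Lp_space_def)
qed

lemma Lp_space_sum:
  assumes "0 < p" "finite I" "\<And>i. i \<in> I \<Longrightarrow> f i \<in> Lp_space p"
  shows "(\<lambda>t. \<Sum>i\<in>I. f i t) \<in> Lp_space p"
  using assms(2,3)
proof (induction I rule: finite_induct)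
  case empty
  then show ?case by (simp add: Lp_space_def)
next
  case (insert i I)
  then show ?case using Lp_space_add[OF assms(1)] by simp
qed

lemma lincomb_in_Lp_space:
  assumes "0 < p" "\<And>b. b \<in> Basis \<Longrightarrow> s b \<in> Lp_space p"
  shows "lincomb s x \<in> Lp_space p"
  unfolding lincomb_def using assms by (intro Lp_space_sum Lp_space_scale) auto

section \<open>Moments of stable projections\<close>

text \<open>The absolute moment of the standard symmetric stable law, possibly infinite. The law is
  selected by its characteristic function; its existence is shown only where a nondegenerate stable
  law is at hand.\<close>

definition stable_moment :: "real \<Rightarrow> real \<Rightarrow> ennreal" where
  "stable_moment q p = (\<integral>\<^sup>+ x. ennreal (\<bar>x\<bar> powr p) \<partial>(SOME D. real_distribution D \<and>
     char D = (\<lambda>t. complex_of_real (exp (- (\<bar>t\<bar> powr q))))))"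

text \<open>For \<open>\<sigma> > 0\<close> the law is the standard one scaled by
  \<open>\<sigma> powr (1 / q)\<close>. For \<open>\<sigma> = 0\<close> it is the point mass at the
  origin and both sides vanish, even if \<open>stable_moment q p\<close> is infinite.\<close>

lemma nn_integral_stable:
  assumes "real_distribution D" "0 < q" "0 < p" "0 \<le> \<sigma>"
    and char: "\<And>t. char D t = complex_of_real (exp (- (\<bar>t\<bar> powr q * \<sigma>)))"
  shows "(\<integral>\<^sup>+ x. ennreal (\<bar>x\<bar> powr p) \<partial>D) = stable_moment q p * ennreal (\<sigma> powr (p / q))"
proof -
  interpret D: real_distribution D by fact
  show ?thesis
  proof (cases "\<sigma> = 0")
    case True
    define D0 where "D0 = distr D borel (\<lambda>_. 0 :: real)"
    have D0: "real_distribution D0" unfolding D0_def by (rule D.real_distribution_distr) simp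
    have "char D = char D0"
    proof
      fix t
      have "char D0 t = 1"
        unfolding D0_def char_def using D.prob_space by (subst integral_distr) simp_all
      then show "char D t = char D0 t"
        using True by (simp add: char)
    qed
    then have "D = D0" by (intro Levy_uniqueness assms D0)
    then have "(\<integral>\<^sup>+ x. ennreal (\<bar>x\<bar> powr p) \<partial>D) = (\<integral>\<^sup>+ x. ennreal (\<bar>x\<bar> powr p) \<partial>D0)"
      by (rule arg_cong)
    also have "\<dots> = (\<integral>\<^sup>+ x. ennreal (\<bar>0::real\<bar> powr p) \<partial>D)"
      unfolding D0_def by (rule nn_integral_distr) measurable
    finally show ?thesis using True assms by simp
  next
    case False
    define c where "c = \<sigma> powr (1 / q)"
    have c: "0 < c" using False assms by (simp add: c_def)
    define D1 where "D1 = distr D borel (\<lambda>x. x / c)"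
    have D1: "real_distribution D1" unfolding D1_def by (rule D.real_distribution_distr) simp
    have char1: "char D1 = (\<lambda>t. complex_of_real (exp (- (\<bar>t\<bar> powr q))))"
    proof
      fix t
      have "char D1 t = char D (t / c)"
        unfolding D1_def char_def by (simp add: integral_distr)
      moreover have "\<bar>t / c\<bar> powr q * \<sigma> = \<bar>t\<bar> powr q"
        using c False assms by (simp add: c_def powr_divide powr_powr)
      ultimately show "char D1 t = complex_of_real (exp (- (\<bar>t\<bar> powr q)))"
        by (simp only: char)
    qed
    \<comment> \<open>Normalising \<open>D\<close> itself proves that a standard law exists, and
      Levy uniqueness pins the choice to \<open>D1\<close>.\<close>
    have "(SOME D. real_distribution D \<and> char D = (\<lambda>t. complex_of_real (exp (- (\<bar>t\<bar> powr q))))) = D1"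
    proof (rule some_equality)
      fix D'
      assume "real_distribution D' \<and> char D' = (\<lambda>t. complex_of_real (exp (- (\<bar>t\<bar> powr q))))"
      with D1 char1 show "D' = D1" by (intro Levy_uniqueness) simp_all
    qed (use D1 char1 in simp)
    then have "stable_moment q p = (\<integral>\<^sup>+ x. ennreal (\<bar>x\<bar> powr p) \<partial>D1)"
      by (simp add: stable_moment_def)
    also have "\<dots> = (\<integral>\<^sup>+ x. ennreal (\<bar>x / c\<bar> powr p) \<partial>D)"
      unfolding D1_def by (subst nn_integral_distr) auto
    finally have "stable_moment q p * ennreal (c powr p) =
        (\<integral>\<^sup>+ x. ennreal (\<bar>x / c\<bar> powr p) * ennreal (c powr p) \<partial>D)"
      by (simp add: nn_integral_multc)
    also have "\<dots> = (\<integral>\<^sup>+ x. ennreal (\<bar>x\<bar> powr p) \<partial>D)"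
      using c by (intro nn_integral_cong) (simp add: powr_divide flip: ennreal_mult')
    finally show ?thesis by (simp add: c_def powr_powr)
  qed
qed

lemma char_distr_inner:
  assumes "Z \<in> borel_measurable P"
  shows "char (distr P borel (\<lambda>\<omega>. a \<bullet> Z \<omega>)) t = char_functional P Z (t *\<^sub>R a)"
  unfolding char_def char_functional_def using assms by (subst integral_distr) simp_all

lemma symmetric_stableE:
  assumes "symmetric_stable q P Z" "0 < q"
  obtains s where "\<And>x. lincomb s x \<in> Lp_space q"
    and "\<And>x. char_functional P Z x = complex_of_real (exp (- Lp_power q (lincomb s x)))"
proof -
  from assms(1) obtain s where "\<forall>b\<in>Basis. s b \<in> Lp_space q"
    and "\<forall>x. char_functional P Z x = complex_of_real (exp (- (LINT t|unit_interval.
               \<bar>\<Sum>b\<in>Basis. (x \<bullet> b) * s b t\<bar> powr q)))"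
    unfolding symmetric_stable_def by blast
  with assms(2) show thesis
    by (intro that[of s] lincomb_in_Lp_space) (auto simp: Lp_power_def lincomb_def)
qed

lemma lincomb_scaleR: "lincomb s (c *\<^sub>R x) = (\<lambda>t. c * lincomb s x t)"
  by (simp add: fun_eq_iff linear_scale[OF linear_lincomb, simplified])

lemma lincomb_add: "lincomb s (x + y) = (\<lambda>t. lincomb s x t + lincomb s y t)"
  by (simp add: fun_eq_iff linear_add[OF linear_lincomb, simplified])

lemma lincomb_diff: "lincomb s (x - y) = (\<lambda>t. lincomb s x t - lincomb s y t)"
  by (simp add: fun_eq_iff linear_diff[OF linear_lincomb, simplified])

text \<open>The projection to \<open>a\<close> is scalar stable: by homogeneity its exponent at
  \<open>t\<close> is \<open>\<bar>t\<bar> powr q\<close> times the exponent of \<open>Z\<close> at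
  \<open>a\<close>.\<close>

lemma nn_integral_stable_inner:
  assumes "prob_space P" and Z: "Z \<in> borel_measurable P" and "0 < q" "0 < p"
    and char: "\<And>x. char_functional P Z x = complex_of_real (exp (- Lp_power q (lincomb s x)))"
  shows "(\<integral>\<^sup>+ \<omega>. ennreal (\<bar>a \<bullet> Z \<omega>\<bar> powr p) \<partial>P) =
    stable_moment q p * ennreal (Lp_power q (lincomb s a) powr (p / q))"
proof -
  interpret prob_space P by fact
  have meas: "(\<lambda>\<omega>. a \<bullet> Z \<omega>) \<in> borel_measurable P" using Z by measurable
  have "(\<integral>\<^sup>+ \<omega>. ennreal (\<bar>a \<bullet> Z \<omega>\<bar> powr p) \<partial>P) =
      (\<integral>\<^sup>+ x. ennreal (\<bar>x\<bar> powr p) \<partial>(distr P borel (\<lambda>\<omega>. a \<bullet> Z \<omega>)))"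
    using meas by (subst nn_integral_distr) simp_all
  also have "\<dots> = stable_moment q p * ennreal (Lp_power q (lincomb s a) powr (p / q))"
  proof (rule nn_integral_stable)
    show "real_distribution (distr P borel (\<lambda>\<omega>. a \<bullet> Z \<omega>))"
      using meas by (rule real_distribution_distr)
    fix t
    show "char (distr P borel (\<lambda>\<omega>. a \<bullet> Z \<omega>)) t =
        complex_of_real (exp (- (\<bar>t\<bar> powr q * Lp_power q (lincomb s a))))"
      unfolding char_distr_inner[OF Z] char lincomb_scaleR Lp_power_scale ..
  qed (use assms in simp_all)
  finally show ?thesis .
qed

lemma sigma_finite_unit_interval: "sigma_finite_measure unit_interval"
  by (intro finite_measure.sigma_finite_measure finite_measure_lebesgue_on) simp

text \<open>Tonelli on the product of \<open>P\<close> and the unit interval, with the scalar moment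
  formula applied at each \<open>t\<close>.\<close>

lemma nn_integral_stable_field:
  fixes G :: "real \<Rightarrow> 'v::euclidean_space" and Z :: "'b \<Rightarrow> 'v"
  assumes "prob_space P" and Z[measurable]: "Z \<in> borel_measurable P" and "0 < q" "0 < p"
    and char: "\<And>x. char_functional P Z x = complex_of_real (exp (- Lp_power q (lincomb s x)))"
    and G[measurable]: "G \<in> borel_measurable unit_interval"
  shows borel_measurable_stable_field:
      "(\<lambda>t. stable_moment q p * ennreal (Lp_power q (lincomb s (G t)) powr (p / q)))
        \<in> borel_measurable unit_interval" (is "?f \<in> _")
    and nn_integral_stable_field_eq:
      "(\<integral>\<^sup>+ \<omega>. (\<integral>\<^sup>+ t. ennreal (\<bar>G t \<bullet> Z \<omega>\<bar> powr p) \<partial>unit_interval) \<partial>P) =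
        (\<integral>\<^sup>+ t. stable_moment q p * ennreal (Lp_power q (lincomb s (G t)) powr (p / q)) \<partial>unit_interval)"
proof -
  interpret P: prob_space P by fact
  interpret U: sigma_finite_measure unit_interval by (rule sigma_finite_unit_interval)
  interpret pair_sigma_finite P unit_interval ..
  \<comment> \<open>Written as an inner expectation, the integrand inherits measurability from the
    joint integrand.\<close>
  have f: "?f = (\<lambda>t. \<integral>\<^sup>+ \<omega>. ennreal (\<bar>G t \<bullet> Z \<omega>\<bar> powr p) \<partial>P)"
    using assms by (simp add: nn_integral_stable_inner)
  have [measurable]: "(\<lambda>(\<omega>, t). ennreal (\<bar>G t \<bullet> Z \<omega>\<bar> powr p)) \<in> borel_measurable (P \<Otimes>\<^sub>M unit_interval)"
    by measurable
  show "?f \<in> borel_measurable unit_interval"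
    unfolding f by measurable
  show "(\<integral>\<^sup>+ \<omega>. (\<integral>\<^sup>+ t. ennreal (\<bar>G t \<bullet> Z \<omega>\<bar> powr p) \<partial>unit_interval) \<partial>P) =
      (\<integral>\<^sup>+ t. ?f t \<partial>unit_interval)"
    unfolding f by (rule Fubini'[symmetric]) measurable
qed

section \<open>Integral representation of the norm\<close>

text \<open>The coordinates of \<open>G t\<close> are the values \<open>T b t\<close>, so the
  pairing with \<open>x\<close> is linear for every \<open>t\<close>. The null set where it differs
  from \<open>T x t\<close> may depend on \<open>x\<close>, which is harmless because each norm is
  computed for a fixed \<open>x\<close>.\<close>

lemma subspace_of_LpE:
  fixes nrm :: "'v::euclidean_space \<Rightarrow> real"
  assumes "subspace_of_Lp p nrm" "0 < p"
  obtains G where "G \<in> borel_measurable unit_interval"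
    and "\<And>x. ennreal (nrm x powr p) = (\<integral>\<^sup>+ t. ennreal (\<bar>G t \<bullet> x\<bar> powr p) \<partial>unit_interval)"
proof -
  from assms(1) obtain T :: "'v \<Rightarrow> real \<Rightarrow> real" where
      T: "\<And>x. T x \<in> Lp_space p"
    and add: "\<And>x y. AE t in unit_interval. T (x + y) t = T x t + T y t"
    and scale: "\<And>c x. AE t in unit_interval. T (c *\<^sub>R x) t = c * T x t"
    and nrm: "\<And>x. nrm x = Lp_norm p (T x)"
    unfolding subspace_of_Lp_def by blast
  define G where "G = (\<lambda>t. \<Sum>b\<in>Basis. T b t *\<^sub>R b)"
  note [measurable] = Lp_spaceD(1)[OF T]
  have G[measurable]: "G \<in> borel_measurable unit_interval"
    unfolding G_def by measurable
  \<comment> \<open>Only finitely many null sets are collected; the empty sum needs that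
    \<open>T 0\<close> vanishes almost everywhere.\<close>
  have sum: "AE t in unit_interval. T (\<Sum>b\<in>B. (x \<bullet> b) *\<^sub>R b) t = (\<Sum>b\<in>B. (x \<bullet> b) * T b t)"
    if "finite B" for B and x :: 'v
    using that
  proof (induction B rule: finite_induct)
    case empty
    then show ?case using scale[of 0 0] by simp
  next
    case (insert b B)
    from insert.IH add[of "(x \<bullet> b) *\<^sub>R b" "\<Sum>b\<in>B. (x \<bullet> b) *\<^sub>R b"] scale[of "x \<bullet> b" b]
    show ?case
    proof eventually_elim
      case (elim t)
      with insert.hyps show ?case by simp
    qed
  qed
  have T_G: "AE t in unit_interval. T x t = G t \<bullet> x" for x
  proof -
    have "G t \<bullet> x = (\<Sum>b\<in>Basis. (x \<bullet> b) * T b t)" for t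
      by (simp add: G_def inner_sum_left inner_commute[of x] mult.commute)
    with sum[OF finite_Basis, of x] show ?thesis
      by (simp only: euclidean_representation)
  qed
  have "ennreal (nrm x powr p) = (\<integral>\<^sup>+ t. ennreal (\<bar>G t \<bullet> x\<bar> powr p) \<partial>unit_interval)" for x
  proof -
    have "nrm x powr p = (LINT t|unit_interval. \<bar>T x t\<bar> powr p)"
      using assms(2) by (simp add: nrm Lp_norm_def powr_powr)
    also have "ennreal \<dots> = (\<integral>\<^sup>+ t. ennreal (\<bar>T x t\<bar> powr p) \<partial>unit_interval)"
      by (rule nn_integral_eq_integral[symmetric]) (use Lp_spaceD(2)[OF T] in auto)
    also have "\<dots> = (\<integral>\<^sup>+ t. ennreal (\<bar>G t \<bullet> x\<bar> powr p) \<partial>unit_interval)"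
    proof (rule nn_integral_cong_AE)
      show "AE t in unit_interval. ennreal (\<bar>T x t\<bar> powr p) = ennreal (\<bar>G t \<bullet> x\<bar> powr p)"
        using T_G[of x] by eventually_elim simp
    qed
    finally show ?thesis .
  qed
  with G show thesis by (rule that)
qed

section \<open>Parallelogram relations in \<open>L_q\<close>\<close>

lemma Lp_space_diff:
  assumes "0 < p" "f \<in> Lp_space p" "g \<in> Lp_space p"
  shows "(\<lambda>t. f t - g t) \<in> Lp_space p"
  using Lp_space_add[OF assms(1,2) Lp_space_scale[OF assms(3), of "- 1"]] by simp

lemma Lp_power_parallelogram_le:
  assumes "0 < q" "q \<le> 2" "f \<in> Lp_space q" "g \<in> Lp_space q"
  shows "Lp_power q (\<lambda>t. f t + g t) + Lp_power q (\<lambda>t. f t - g t) \<le> 2 * (Lp_power q f + Lp_power q g)"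
proof -
  note int = assms(3,4)[THEN Lp_spaceD(2)] Lp_space_add[OF assms(1,3,4), THEN Lp_spaceD(2)]
    Lp_space_diff[OF assms(1,3,4), THEN Lp_spaceD(2)]
  have "(LINT t|unit_interval. \<bar>f t + g t\<bar> powr q + \<bar>f t - g t\<bar> powr q) \<le>
      (LINT t|unit_interval. 2 * (\<bar>f t\<bar> powr q + \<bar>g t\<bar> powr q))"
    using int abs_powr_parallelogram_le[OF assms(1,2)]
    by (intro integral_mono integrable_mult_right Bochner_Integration.integrable_add)
  with int show ?thesis by (simp add: Lp_power_def)
qed

lemma abs_powr_two [simp]: "\<bar>x::real\<bar> powr 2 = x\<^sup>2"
  by (cases "x = 0") simp_all

text \<open>Polarization writes \<open>f t * g t\<close> through the squares of
  \<open>f + g\<close>, \<open>f\<close> and \<open>g\<close>, so closure of the space under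
  addition already gives integrability.\<close>

lemma Lp_power_two_sum:
  assumes f: "f \<in> Lp_space 2" and g: "g \<in> Lp_space 2"
  shows integrable_L2_mult: "integrable unit_interval (\<lambda>t. f t * g t)"
    and Lp_power_two_add: "Lp_power 2 (\<lambda>t. f t + g t) =
      Lp_power 2 f + Lp_power 2 g + 2 * (LINT t|unit_interval. f t * g t)"
    and Lp_power_two_diff: "Lp_power 2 (\<lambda>t. f t - g t) =
      Lp_power 2 f + Lp_power 2 g - 2 * (LINT t|unit_interval. f t * g t)"
proof -
  note int = f[THEN Lp_spaceD(2)] g[THEN Lp_spaceD(2)]
    Lp_space_add[OF _ f g, THEN Lp_spaceD(2)]
  have "integrable unit_interval (\<lambda>t. ((f t + g t)\<^sup>2 - (f t)\<^sup>2 - (g t)\<^sup>2) / 2)"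
    using int by (intro integrable_divide Bochner_Integration.integrable_diff) simp_all
  then show *: "integrable unit_interval (\<lambda>t. f t * g t)"
    by (simp add: power2_eq_square algebra_simps)
  show "Lp_power 2 (\<lambda>t. f t + g t) =
      Lp_power 2 f + Lp_power 2 g + 2 * (LINT t|unit_interval. f t * g t)"
    using int * by (simp add: Lp_power_def power2_sum mult.assoc)
  show "Lp_power 2 (\<lambda>t. f t - g t) =
      Lp_power 2 f + Lp_power 2 g - 2 * (LINT t|unit_interval. f t * g t)"
    using int * by (simp add: Lp_power_def power2_diff mult.assoc)
qed

text \<open>The pointwise defect \<open>?d\<close> is nonnegative with integral zero, hence zero
  almost everywhere; the strict scalar inequality then excludes two nonzero values.\<close>

lemma AE_disjoint_of_Lp_power_parallelogram:
  assumes "0 < q" "q < 2" and f: "f \<in> Lp_space q" and g: "g \<in> Lp_space q"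
    and eq: "Lp_power q (\<lambda>t. f t + g t) + Lp_power q (\<lambda>t. f t - g t) = 2 * (Lp_power q f + Lp_power q g)"
  shows "AE t in unit_interval. f t = 0 \<or> g t = 0"
proof -
  let ?d = "\<lambda>t. 2 * (\<bar>f t\<bar> powr q + \<bar>g t\<bar> powr q) - (\<bar>f t + g t\<bar> powr q + \<bar>f t - g t\<bar> powr q)"
  note int = f[THEN Lp_spaceD(2)] g[THEN Lp_spaceD(2)]
    Lp_space_add[OF assms(1) f g, THEN Lp_spaceD(2)] Lp_space_diff[OF assms(1) f g, THEN Lp_spaceD(2)]
  have int_d: "integrable unit_interval ?d"
    by (intro integrable_mult_right Bochner_Integration.integrable_add Bochner_Integration.integrable_diff int)
  have "(LINT t|unit_interval. ?d t) = 0"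
    using int eq by (simp add: Lp_power_def)
  moreover have "AE t in unit_interval. 0 \<le> ?d t"
    using abs_powr_parallelogram_le[of q] assms by (intro AE_I2) simp
  ultimately have "AE t in unit_interval. ?d t = 0"
    using integral_nonneg_eq_0_iff_AE[OF int_d] by simp
  then show ?thesis
  proof eventually_elim
    case (elim t)
    then show ?case using abs_powr_parallelogram_less[of q "f t" "g t"] assms by force
  qed
qed

text \<open>For \<open>q < 2\<close> the hypothesis forces disjoint supports, for \<open>q = 2\<close> orthogonality; either
  property passes to linear combinations.\<close>

lemma Lp_power_add_of_pairwise:
  fixes f :: "'i \<Rightarrow> real \<Rightarrow> real" and g :: "'j \<Rightarrow> real \<Rightarrow> real"
  assumes "0 < q" "q \<le> 2" "finite I" "finite J"
    and f: "\<And>i. i \<in> I \<Longrightarrow> f i \<in> Lp_space q" and g: "\<And>j. j \<in> J \<Longrightarrow> g j \<in> Lp_space q"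
    and add: "\<And>i j. i \<in> I \<Longrightarrow> j \<in> J \<Longrightarrow>
      Lp_power q (\<lambda>t. f i t + g j t) = Lp_power q (f i) + Lp_power q (g j)"
    and diff: "\<And>i j. i \<in> I \<Longrightarrow> j \<in> J \<Longrightarrow>
      Lp_power q (\<lambda>t. f i t - g j t) = Lp_power q (f i) + Lp_power q (g j)"
  shows "Lp_power q (\<lambda>t. (\<Sum>i\<in>I. a i * f i t) + (\<Sum>j\<in>J. b j * g j t)) =
    Lp_power q (\<lambda>t. \<Sum>i\<in>I. a i * f i t) + Lp_power q (\<lambda>t. \<Sum>j\<in>J. b j * g j t)"
proof -
  define F where "F = (\<lambda>t. \<Sum>i\<in>I. a i * f i t)"
  define H where "H = (\<lambda>t. \<Sum>j\<in>J. b j * g j t)"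
  have FH: "F \<in> Lp_space q" "H \<in> Lp_space q"
    unfolding F_def H_def using assms by (auto intro!: Lp_space_sum Lp_space_scale)
  have "Lp_power q (\<lambda>t. F t + H t) = Lp_power q F + Lp_power q H"
  proof (cases "q = 2")
    case True
    have f2: "\<And>i. i \<in> I \<Longrightarrow> f i \<in> Lp_space 2" and g2: "\<And>j. j \<in> J \<Longrightarrow> g j \<in> Lp_space 2"
      using f g True by auto
    \<comment> \<open>Comparing \<open>add\<close> with the expanded square leaves twice the cross
      integral equal to zero.\<close>
    have orth: "(LINT t|unit_interval. f i t * g j t) = 0" if "i \<in> I" "j \<in> J" for i j
      using Lp_power_two_add[OF f2[OF that(1)] g2[OF that(2)]] add[OF that] True by simp
    have "(LINT t|unit_interval. F t * H t) =
        (LINT t|unit_interval. (\<Sum>i\<in>I. \<Sum>j\<in>J. a i * b j * (f i t * g j t)))"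
      by (simp add: F_def H_def sum_product mult.assoc mult.left_commute)
    also have "\<dots> = (\<Sum>i\<in>I. \<Sum>j\<in>J. a i * b j * (LINT t|unit_interval. f i t * g j t))"
      using f2 g2 by (simp add: Bochner_Integration.integral_sum
          Bochner_Integration.integrable_sum integrable_L2_mult)
    also have "\<dots> = 0"
      by (intro sum.neutral ballI) (simp add: orth)
    finally show ?thesis
      using Lp_power_two_add[of F H] FH True by simp
  next
    case False
    \<comment> \<open>The sum of \<open>add\<close> and \<open>diff\<close> is equality in the
      parallelogram inequality.\<close>
    have "AE t in unit_interval. f i t = 0 \<or> g j t = 0" if "i \<in> I" "j \<in> J" for i j
      using False assms that by (intro AE_disjoint_of_Lp_power_parallelogram[of q]) auto
    then have "AE t in unit_interval. \<forall>i\<in>I. \<forall>j\<in>J. f i t = 0 \<or> g j t = 0"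
      by (simp only: AE_finite_all[OF assms(3)] AE_finite_all[OF assms(4)]) blast
    then have "AE t in unit_interval. \<bar>F t + H t\<bar> powr q = \<bar>F t\<bar> powr q + \<bar>H t\<bar> powr q"
    proof eventually_elim
      case (elim t)
      \<comment> \<open>If some \<open>f i t\<close> is nonzero, every \<open>g j t\<close> must
        vanish.\<close>
      then have "(\<forall>i\<in>I. f i t = 0) \<or> (\<forall>j\<in>J. g j t = 0)" by blast
      then have "F t = 0 \<or> H t = 0" by (auto simp: F_def H_def)
      then show ?case by auto
    qed
    moreover note [measurable] = FH[THEN Lp_spaceD(1)]
    ultimately have "Lp_power q (\<lambda>t. F t + H t) = (LINT t|unit_interval. \<bar>F t\<bar> powr q + \<bar>H t\<bar> powr q)"
      unfolding Lp_power_def by (intro integral_cong_AE) measurable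
    also have "\<dots> = Lp_power q F + Lp_power q H"
      unfolding Lp_power_def by (intro Bochner_Integration.integral_add FH[THEN Lp_spaceD(2)])
    finally show ?thesis .
  qed
  then show ?thesis by (simp add: F_def H_def)
qed

section \<open>Independence and additivity of the exponent\<close>

lemma (in prob_space) char_functional_indep_add:
  assumes "indep_var borel (\<lambda>\<omega>. a \<bullet> Z \<omega>) borel (\<lambda>\<omega>. b \<bullet> Z \<omega>)" "Z \<in> borel_measurable M"
  shows "char_functional M Z (a + b) = char_functional M Z a * char_functional M Z b"
  using char_distr_add[OF assms(1), of 1] char_distr_inner[OF assms(2), of _ 1]
  by (simp flip: inner_add_left)

text \<open>Independence of pairs of coordinates makes the exponent additive at
  \<open>e i + e' j\<close> and \<open>e i - e' j\<close>; \<open>Lp_power_add_of_pairwise\<close>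
  extends this to whole blocks.\<close>

lemma stable_exponent_add_of_indep:
  fixes Y :: "'b \<Rightarrow> (real ^ 'k) \<times> (real ^ 'm)"
  assumes "prob_space N" and Y[measurable]: "Y \<in> borel_measurable N" and q: "0 < q" "q \<le> 2"
    and Lp: "\<And>x. lincomb s x \<in> Lp_space q"
    and char: "\<And>x. char_functional N Y x = complex_of_real (exp (- Lp_power q (lincomb s x)))"
    and indep: "\<And>i j. prob_space.indep_var N borel (\<lambda>\<omega>. fst (Y \<omega>) $ i) borel (\<lambda>\<omega>. snd (Y \<omega>) $ j)"
  shows "Lp_power q (lincomb s (u, v)) = Lp_power q (lincomb s (u, 0)) + Lp_power q (lincomb s (0, v))"
proof -
  interpret prob_space N by fact
  define e :: "'k \<Rightarrow> (real ^ 'k) \<times> (real ^ 'm)" where "e i = (axis i 1, 0)" for i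
  define e' :: "'m \<Rightarrow> (real ^ 'k) \<times> (real ^ 'm)" where "e' j = (0, axis j 1)" for j
  have e: "e i \<bullet> x = fst x $ i" and e': "e' j \<bullet> x = snd x $ j" for i j x
    by (simp_all add: e_def e'_def inner_prod_def inner_axis')
  have exponent: "Lp_power q (lincomb s (a + b)) = Lp_power q (lincomb s a) + Lp_power q (lincomb s b)"
    if "indep_var borel (\<lambda>\<omega>. a \<bullet> Y \<omega>) borel (\<lambda>\<omega>. b \<bullet> Y \<omega>)" for a b
  proof -
    \<comment> \<open>Both sides are exponentials of real numbers, so no complex logarithm is
      involved.\<close>
    have "complex_of_real (exp (- Lp_power q (lincomb s (a + b)))) =
        complex_of_real (exp (- (Lp_power q (lincomb s a) + Lp_power q (lincomb s b))))"
      using char_functional_indep_add[OF that Y] by (simp only: char minus_add_distrib exp_add of_real_mult)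
    then show ?thesis by (simp only: of_real_eq_iff exp_inj_iff neg_equal_iff_equal)
  qed
  have plus: "Lp_power q (lincomb s (e i + e' j)) = Lp_power q (lincomb s (e i)) + Lp_power q (lincomb s (e' j))"
    for i j
    using indep[of i j] by (intro exponent) (simp add: e e')
  \<comment> \<open>Negating the second coordinate preserves independence, and the exponent is
    even.\<close>
  have minus: "Lp_power q (lincomb s (e i - e' j)) = Lp_power q (lincomb s (e i)) + Lp_power q (lincomb s (e' j))"
    for i j
  proof -
    have "indep_var borel ((\<lambda>x. x) \<circ> (\<lambda>\<omega>. fst (Y \<omega>) $ i)) borel (uminus \<circ> (\<lambda>\<omega>. snd (Y \<omega>) $ j))"
      using indep[of i j] by (rule indep_var_compose) measurable
    then have "indep_var borel (\<lambda>\<omega>. e i \<bullet> Y \<omega>) borel (\<lambda>\<omega>. ((- 1) *\<^sub>R e' j) \<bullet> Y \<omega>)"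
      by (simp add: e e' o_def)
    from exponent[OF this] show ?thesis
      by (simp only: lincomb_scaleR Lp_power_scale) simp
  qed
  have expansion: "(\<Sum>i\<in>UNIV. x $ i *\<^sub>R axis i 1) = x" for x :: "real ^ 'n"
    using basis_expansion[of x] by (simp add: scalar_mult_eq_scaleR)
  have u: "(u, 0) = (\<Sum>i\<in>UNIV. u $ i *\<^sub>R e i)" and v: "(0, v) = (\<Sum>j\<in>UNIV. v $ j *\<^sub>R e' j)"
    by (simp_all add: prod_eq_iff fst_sum snd_sum e_def e'_def expansion)
  have lu: "lincomb s (u, 0) = (\<lambda>t. \<Sum>i\<in>UNIV. u $ i * lincomb s (e i) t)"
    unfolding u by (simp add: fun_eq_iff linear_sum[OF linear_lincomb] linear_scale[OF linear_lincomb])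
  have lv: "lincomb s (0, v) = (\<lambda>t. \<Sum>j\<in>UNIV. v $ j * lincomb s (e' j) t)"
    unfolding v by (simp add: fun_eq_iff linear_sum[OF linear_lincomb] linear_scale[OF linear_lincomb])
  have "lincomb s (u, v) = (\<lambda>t. lincomb s (u, 0) t + lincomb s (0, v) t)"
    by (simp flip: lincomb_add)
  moreover have "Lp_power q (\<lambda>t. lincomb s (u, 0) t + lincomb s (0, v) t) =
      Lp_power q (lincomb s (u, 0)) + Lp_power q (lincomb s (0, v))"
    unfolding lu lv using q Lp plus minus
    by (intro Lp_power_add_of_pairwise) (simp_all add: lincomb_add lincomb_diff)
  ultimately show ?thesis by simp
qed

section \<open>Prescribed marginals and symmetrization\<close>

lemma borel_measurable_fst_snd [measurable (raw)]:
  fixes Z :: "'b \<Rightarrow> 'u::euclidean_space \<times> 'w::euclidean_space"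
  assumes "Z \<in> borel_measurable P"
  shows "(\<lambda>\<omega>. fst (Z \<omega>)) \<in> borel_measurable P" "(\<lambda>\<omega>. snd (Z \<omega>)) \<in> borel_measurable P"
  using assms by (simp_all add: borel_measurable_continuous_on[OF continuous_on_fst[OF continuous_on_id]]
      borel_measurable_continuous_on[OF continuous_on_snd[OF continuous_on_id]])

text \<open>Pairing with \<open>(u, 0)\<close> sees only the first block, so all members of a
  \<open>stable_class\<close> have the same exponent there.\<close>

lemma char_functional_fst:
  fixes Z :: "'b \<Rightarrow> 'u::euclidean_space \<times> 'w::euclidean_space"
  assumes [measurable]: "Z \<in> borel_measurable P"
  shows "char_functional P Z (u, 0) = char_functional (distr P borel (\<lambda>\<omega>. fst (Z \<omega>))) (\<lambda>x. x) u"
  unfolding char_functional_def by (subst integral_distr) (simp_all add: inner_prod_def)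

lemma char_functional_snd:
  fixes Z :: "'b \<Rightarrow> 'u::euclidean_space \<times> 'w::euclidean_space"
  assumes [measurable]: "Z \<in> borel_measurable P"
  shows "char_functional P Z (0, v) = char_functional (distr P borel (\<lambda>\<omega>. snd (Z \<omega>))) (\<lambda>x. x) v"
  unfolding char_functional_def by (subst integral_distr) (simp_all add: inner_prod_def)

text \<open>Averaging over \<open>Z\<close> and its reflection \<open>(Z\<^sub>1, - Z\<^sub>2)\<close>, which has the same expected power,
  turns the claim into a pointwise comparison of stable exponents.\<close>

lemma expected_power_stable_symmetrized:
  fixes Z :: "'b \<Rightarrow> 'u::euclidean_space \<times> 'w::euclidean_space"
  assumes P: "prob_space P" and Z[measurable]: "Z \<in> borel_measurable P" and "0 < q" "0 < p"
    and char: "\<And>x. char_functional P Z x = complex_of_real (exp (- Lp_power q (lincomb s x)))"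
    and G[measurable]: "G \<in> borel_measurable unit_interval"
    and nrm: "\<And>x. ennreal (nrm x powr p) = (\<integral>\<^sup>+ t. ennreal (\<bar>G t \<bullet> x\<bar> powr p) \<partial>unit_interval)"
    and sym: "\<And>u v. nrm (u, v) = nrm (u, - v)"
  shows "2 * expected_power p nrm P Z = (\<integral>\<^sup>+ t. stable_moment q p *
    ennreal (Lp_power q (lincomb s (fst (G t), snd (G t))) powr (p / q) +
      Lp_power q (lincomb s (fst (G t), - snd (G t))) powr (p / q)) \<partial>unit_interval)"
proof -
  \<comment> \<open>The sign moves from the vector to the field: pairing \<open>G' t\<close> with
    \<open>x\<close> equals pairing \<open>G t\<close> with the reflected \<open>x\<close>, so by
    symmetry of \<open>nrm\<close> both fields represent the same norm.\<close>
  define G' where "G' = (\<lambda>t. (fst (G t), - snd (G t)))"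
  have [measurable]: "G' \<in> borel_measurable unit_interval"
    unfolding G'_def by (intro borel_measurable_Pair) measurable
  have nrm': "ennreal (nrm x powr p) = (\<integral>\<^sup>+ t. ennreal (\<bar>G' t \<bullet> x\<bar> powr p) \<partial>unit_interval)" for x
    using nrm[of "(fst x, - snd x)"] sym[of "fst x" "snd x"] by (simp add: G'_def inner_prod_def)
  note field = nn_integral_stable_field_eq[OF P Z assms(3,4) char]
    borel_measurable_stable_field[OF P Z assms(3,4) char]
  note [measurable] = field(2)
  have "expected_power p nrm P Z =
      (\<integral>\<^sup>+ t. stable_moment q p * ennreal (Lp_power q (lincomb s (G t)) powr (p / q)) \<partial>unit_interval)"
    unfolding expected_power_def nrm by (rule field) measurable
  moreover have "expected_power p nrm P Z =
      (\<integral>\<^sup>+ t. stable_moment q p * ennreal (Lp_power q (lincomb s (G' t)) powr (p / q)) \<partial>unit_interval)"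
    unfolding expected_power_def nrm' by (rule field) measurable
  ultimately have "2 * expected_power p nrm P Z =
      (\<integral>\<^sup>+ t. stable_moment q p * ennreal (Lp_power q (lincomb s (G t)) powr (p / q)) \<partial>unit_interval) +
      (\<integral>\<^sup>+ t. stable_moment q p * ennreal (Lp_power q (lincomb s (G' t)) powr (p / q)) \<partial>unit_interval)"
    by (simp only: mult_2)
  also have "\<dots> = (\<integral>\<^sup>+ t. stable_moment q p * ennreal (Lp_power q (lincomb s (G t)) powr (p / q)) +
      stable_moment q p * ennreal (Lp_power q (lincomb s (G' t)) powr (p / q)) \<partial>unit_interval)"
    by (rule nn_integral_add[symmetric]; rule field(2); measurable)
  finally show ?thesis
    by (simp add: G'_def ennreal_plus flip: distrib_left)
qed

section \<open>Comparison with the independent vector\<close>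

theorem proposition1:
  fixes q p :: real
    and M :: "'a measure" and X :: "'a \<Rightarrow> (real ^ 'k) \<times> (real ^ 'm)"
    and N :: "'b measure" and Y :: "'b \<Rightarrow> (real ^ 'k) \<times> (real ^ 'm)"
    and nrm :: "(real ^ 'k) \<times> (real ^ 'm) \<Rightarrow> real"
  assumes "0 < q" and "q \<le> 2"
    and "symmetric_stable q M X"
    and "(N, Y) \<in> stable_class q M X"
    and "\<forall>i j. prob_space.indep_var N borel (\<lambda>\<omega>. fst (Y \<omega>) $ i) borel (\<lambda>\<omega>. snd (Y \<omega>) $ j)"
    and "0 < p"
    and "subspace_of_Lp p nrm"
    and "\<forall>u v. nrm (u, v) = nrm (u, - v)"
  shows "(p \<le> q \<longrightarrow>
            is_maximum (expected_power p nrm N Y)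
              {expected_power p nrm P Z | (P :: 'b measure) Z. (P, Z) \<in> stable_class q M X}) \<and>
         (q = 2 \<and> 2 < p \<longrightarrow>
            is_minimum (expected_power p nrm N Y)
              {expected_power p nrm P Z | (P :: 'b measure) Z. (P, Z) \<in> stable_class q M X})"
proof -
  note q = assms(1,2) and p = assms(6)
  obtain G where G: "G \<in> borel_measurable unit_interval"
      "\<And>x. ennreal (nrm x powr p) = (\<integral>\<^sup>+ t. ennreal (\<bar>G t \<bullet> x\<bar> powr p) \<partial>unit_interval)"
    using subspace_of_LpE[OF assms(7) p] by blast
  have law: "symmetric_stable q P Z" "prob_space P" "Z \<in> borel_measurable P"
      "distr P borel (\<lambda>\<omega>. fst (Z \<omega>)) = distr M borel (\<lambda>\<omega>. fst (X \<omega>))"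
      "distr P borel (\<lambda>\<omega>. snd (Z \<omega>)) = distr M borel (\<lambda>\<omega>. snd (X \<omega>))"
    if "(P, Z) \<in> stable_class q M X" for P :: "'b measure" and Z
    using that by (auto simp: stable_class_def symmetric_stable_def)
  note Y = law[OF assms(4)]
  obtain s where s: "\<And>x. lincomb s x \<in> Lp_space q"
      "\<And>x. char_functional N Y x = complex_of_real (exp (- Lp_power q (lincomb s x)))"
    using symmetric_stableE[OF Y(1) q(1)] by blast
  \<comment> \<open>Both summands are determined by the marginals, so \<open>A\<close> serves as
    reference for the whole class; for \<open>Y\<close> it is the exponent itself.\<close>
  define A where "A u v = Lp_power q (lincomb s (u, 0)) + Lp_power q (lincomb s (0, v))" for u v
  have A_nonneg: "0 \<le> A u v" for u v by (simp add: A_def)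
  have Y_add: "Lp_power q (lincomb s (u, v)) = A u v" for u v
    unfolding A_def using stable_exponent_add_of_indep[OF Y(2,3) q s] assms(5) by blast
  have A_minus: "A u (- v) = A u v" for u v
    using lincomb_scaleR[of s "- 1" "(0, v)"] Lp_power_scale[of q "- 1" "lincomb s (0, v)"]
    by (simp add: A_def)
  \<comment> \<open>As \<open>A\<close> is even in \<open>v\<close>, the two symmetrized terms
    coincide.\<close>
  have EY: "2 * expected_power p nrm N Y = (\<integral>\<^sup>+ t. stable_moment q p *
      ennreal (2 * A (fst (G t)) (snd (G t)) powr (p / q)) \<partial>unit_interval)"
    using expected_power_stable_symmetrized[where nrm = nrm, OF Y(2,3) q(1) p s(2) G] assms(8)
    by (simp only: Y_add A_minus mult_2)
  have comparison: "(p \<le> q \<longrightarrow> expected_power p nrm P Z \<le> expected_power p nrm N Y) \<and>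
      (q = 2 \<and> 2 < p \<longrightarrow> expected_power p nrm N Y \<le> expected_power p nrm P Z)"
    if PZ: "(P, Z) \<in> stable_class q M X" for P :: "'b measure" and Z
  proof -
    note Z = law[OF PZ]
    obtain s' where s': "\<And>x. lincomb s' x \<in> Lp_space q"
        "\<And>x. char_functional P Z x = complex_of_real (exp (- Lp_power q (lincomb s' x)))"
      using symmetric_stableE[OF Z(1) q(1)] by blast
    let ?B = "\<lambda>u v. Lp_power q (lincomb s' (u, v))"
    have "char_functional P Z (u, 0) = char_functional N Y (u, 0)"
      and "char_functional P Z (0, v) = char_functional N Y (0, v)" for u v
      unfolding char_functional_fst[OF Y(3)] char_functional_fst[OF Z(3)]
        char_functional_snd[OF Y(3)] char_functional_snd[OF Z(3)] Y(4,5) Z(4,5) by (rule refl)+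
    then have marg: "A u v = ?B u 0 + ?B 0 v" for u v
      by (simp add: A_def s s')
    have split: "lincomb s' (u, v) = (\<lambda>t. lincomb s' (u, 0) t + lincomb s' (0, v) t)"
        "lincomb s' (u, - v) = (\<lambda>t. lincomb s' (u, 0) t - lincomb s' (0, v) t)" for u v
      by (simp_all flip: lincomb_add lincomb_diff)
    have EZ: "2 * expected_power p nrm P Z = (\<integral>\<^sup>+ t. stable_moment q p *
        ennreal (?B (fst (G t)) (snd (G t)) powr (p / q) + ?B (fst (G t)) (- snd (G t)) powr (p / q)) \<partial>unit_interval)"
      using expected_power_stable_symmetrized[where nrm = nrm, OF Z(2,3) q(1) p s'(2) G] assms(8) by simp
    have "expected_power p nrm P Z \<le> expected_power p nrm N Y" if "p \<le> q"
    proof -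
      \<comment> \<open>Concavity of the power \<open>p / q\<close> bounds the sum through the mean
        exponent, which the parallelogram inequality bounds by \<open>A u v\<close>.\<close>
      have "?B u v powr (p / q) + ?B u (- v) powr (p / q) \<le> 2 * A u v powr (p / q)" for u v
      proof -
        have "?B u v powr (p / q) + ?B u (- v) powr (p / q) \<le> 2 * ((?B u v + ?B u (- v)) / 2) powr (p / q)"
          using q p that by (intro powr_mean_le) simp_all
        moreover have "(?B u v + ?B u (- v)) / 2 \<le> A u v"
          using Lp_power_parallelogram_le[OF q s'(1) s'(1), of "(u, 0)" "(0, v)"]
          unfolding marg split[of u v] by simp
        then have "2 * ((?B u v + ?B u (- v)) / 2) powr (p / q) \<le> 2 * A u v powr (p / q)"
          using q p by (intro mult_left_mono powr_mono2) simp_all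
        ultimately show ?thesis by (rule order_trans)
      qed
      then have "2 * expected_power p nrm P Z \<le> 2 * expected_power p nrm N Y"
        unfolding EY EZ by (intro nn_integral_mono mult_left_mono ennreal_leI) (simp_all del: prod.collapse)
      \<comment> \<open>The factor \<open>2\<close> is finite and nonzero, so it cancels even when
        the expectations are infinite.\<close>
      then show ?thesis by (simp add: ennreal_mult_le_mult_iff)
    qed
    moreover have "expected_power p nrm N Y \<le> expected_power p nrm P Z" if "q = 2" "2 < p"
    proof -
      have "2 * A u v powr (p / q) \<le> ?B u v powr (p / q) + ?B u (- v) powr (p / q)" for u v
      proof -
        \<comment> \<open>At \<open>q = 2\<close> the cross terms cancel, so the mean exponent is
          exactly \<open>A u v\<close> and convexity alone decides.\<close>
        have "A u v = (?B u v + ?B u (- v)) / 2"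
          using s'(1) unfolding marg split[of u v] \<open>q = 2\<close>
          by (simp add: Lp_power_two_add Lp_power_two_diff)
        with powr_mean_ge[of "?B u v" "?B u (- v)" "p / q"] that show ?thesis
          by (simp only: Lp_power_nonneg)
      qed
      then have "2 * expected_power p nrm N Y \<le> 2 * expected_power p nrm P Z"
        unfolding EY EZ by (intro nn_integral_mono mult_left_mono ennreal_leI) (simp_all del: prod.collapse)
      then show ?thesis by (simp add: ennreal_mult_le_mult_iff)
    qed
    ultimately show ?thesis by blast
  qed
  \<comment> \<open>\<open>Y\<close> itself belongs to the class, so the extremum is
    attained.\<close>
  then show ?thesis
    using assms(4) unfolding is_maximum_def is_minimum_def by blast
qed

end
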